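(* Let $\Omega\subset\mathbb{R}^n$ be a smooth bounded domain, $s\in(0,1)$, and let $p$ be a measurable function on $\Omega\times\Omega$ with $1<p_-\le p_+<\infty$ (where $p_-$, $p_+$ are its essential infimum and supremum). If $t\in(0,s)$ and $r\in(1,p_-)$, then $W^{s,p(\cdot,\cdot)}(\Omega)$ is continuously embedded in $W^{t,r}(\Omega)$. In addition, there is a positive constant $C=C(p_-,p_+,r,s,t,n,\Omega)$ such that for all $f\in W^{s,p(\cdot,\cdot)}(\Omega)$, \[ \Vert f\Vert_{L^r(\Omega)}\le C\Vert f\Vert_{L^{\bar p(\cdot)}(\Omega)}\quad\text{and}\quad [f]_{t,r}\le C[f]_{s,p(\cdot,\cdot)}. \]
   Context: $\bar p(x)=p(x,x)$. For a measurable exponent $e$ on $\Omega$ with $1\le\inf e\le\sup e<\infty$, $L^{e(\cdot)}(\Omega)$ is the set of measurable $f$ with $\int_\Omega|f/\lambda|^{e(x)}dx<\infty$ for some $\lambda>0$, with norm $\inf\{\lambda>0\colon\int_\Omega(|f(x)|/\lambda)^{e(x)}dx<1\}$. The space \[ W^{s,p(\cdot,\cdot)}(\Omega)=\Big\{f\in L^{\bar p(\cdot)}(\Omega)\colon\int_\Omega\int_\Omega\frac{|f(x)-f(y)|^{p(x,y)}}{\lambda^{p(x,y)}|x-y|^{n+sp(x,y)}}dx\,dy<\infty\text{ for some }\lambda>0\Big\}, \] with seminorm $[f]_{s,p(\cdot,\cdot)}=\inf\{\lambda>0\colon\int_\Omega\int_\Omega\frac{|f(x)-f(y)|^{p(x,y)}}{\lambda^{p(x,y)}|x-y|^{n+sp(x,y)}}dx\,dy<1\}$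 and norm $\Vert f\Vert_{L^{\bar p(\cdot)}(\Omega)}+[f]_{s,p(\cdot,\cdot)}$. $W^{t,r}(\Omega)$ is the usual fractional Sobolev space of $f\in L^r(\Omega)$ with $[f]_{t,r}=\big(\int_\Omega\int_\Omega\frac{|f(x)-f(y)|^r}{|x-y|^{n+tr}}dx\,dy\big)^{1/r}<\infty$.
   Formalization: Here p_- and p_+ are the pointwise (not essential) infimum and supremum of p over Ω×Ω; with essential bounds the diagonal exponent p(x,x) is uncontrolled and the L^r inequality fails (e.g. p=10 off the diagonal, p(x,x)=1, r=2). *)

theory Defs
  imports "HOL-Analysis.Analysis"
begin

fun Ck :: "nat \<Rightarrow> ('a::euclidean_space \<Rightarrow> real) \<Rightarrow> bool" where
  "Ck 0 f = continuous_on UNIV f"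
| "Ck (Suc k) f = (\<exists>f'. (\<forall>x. (f has_derivative f' x) (at x)) \<and> (\<forall>v. Ck k (\<lambda>x. f' x v)))"

definition smooth_fun :: "('a::euclidean_space \<Rightarrow> real) \<Rightarrow> bool" where
  "smooth_fun f \<longleftrightarrow> (\<forall>k. Ck k f)"

definition smooth_bounded_domain :: "'a::euclidean_space set \<Rightarrow> bool" where
  "smooth_bounded_domain \<Omega> \<longleftrightarrow> open \<Omega> \<and> connected \<Omega> \<and> bounded \<Omega> \<and> \<Omega> \<noteq> {} \<and>
     (\<exists>\<phi>. smooth_fun \<phi> \<and> \<Omega> = {x. \<phi> x < 0} \<and>
        (\<forall>x\<in>frontier \<Omega>. \<forall>D. (\<phi> has_derivative D) (at x) \<longrightarrow> D \<noteq> (\<lambda>v. 0)))"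

definition var_modular :: "'a::euclidean_space set \<Rightarrow> ('a \<Rightarrow> real) \<Rightarrow> ('a \<Rightarrow> real) \<Rightarrow> real \<Rightarrow> ennreal" where
  "var_modular \<Omega> e f c = (\<integral>\<^sup>+ x\<in>\<Omega>. ennreal ((\<bar>f x\<bar> / c) powr e x) \<partial>lebesgue)"

definition var_Lp :: "'a::euclidean_space set \<Rightarrow> ('a \<Rightarrow> real) \<Rightarrow> ('a \<Rightarrow> real) set" where
  "var_Lp \<Omega> e = {f. f \<in> borel_measurable (lebesgue_on \<Omega>) \<and> (\<exists>c>0. var_modular \<Omega> e f c < \<infinity>)}"

definition var_norm :: "'a::euclidean_space set \<Rightarrow> ('a \<Rightarrow> real) \<Rightarrow> ('a \<Rightarrow> real) \<Rightarrow> real" where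
  "var_norm \<Omega> e f = Inf {c. c > 0 \<and> var_modular \<Omega> e f c < 1}"

definition frac_modular :: "'a::euclidean_space set \<Rightarrow> real \<Rightarrow> ('a \<Rightarrow> 'a \<Rightarrow> real) \<Rightarrow> ('a \<Rightarrow> real) \<Rightarrow> real \<Rightarrow> ennreal" where
  "frac_modular \<Omega> s p f c = (\<integral>\<^sup>+ z\<in>\<Omega> \<times> \<Omega>.
      ennreal (\<bar>f (fst z) - f (snd z)\<bar> powr p (fst z) (snd z) /
        (c powr p (fst z) (snd z) * norm (fst z - snd z) powr (real DIM('a) + s * p (fst z) (snd z)))) \<partial>lebesgue)"

definition W_var :: "'a::euclidean_space set \<Rightarrow> real \<Rightarrow> ('a \<Rightarrow> 'a \<Rightarrow> real) \<Rightarrow> ('a \<Rightarrow> real) set" where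
  "W_var \<Omega> s p = {f. f \<in> var_Lp \<Omega> (\<lambda>x. p x x) \<and> (\<exists>c>0. frac_modular \<Omega> s p f c < \<infinity>)}"

definition var_seminorm :: "'a::euclidean_space set \<Rightarrow> real \<Rightarrow> ('a \<Rightarrow> 'a \<Rightarrow> real) \<Rightarrow> ('a \<Rightarrow> real) \<Rightarrow> real" where
  "var_seminorm \<Omega> s p f = Inf {c. c > 0 \<and> frac_modular \<Omega> s p f c < 1}"

definition Lr_integral :: "'a::euclidean_space set \<Rightarrow> real \<Rightarrow> ('a \<Rightarrow> real) \<Rightarrow> ennreal" where
  "Lr_integral \<Omega> r f = (\<integral>\<^sup>+ x\<in>\<Omega>. ennreal (\<bar>f x\<bar> powr r) \<partial>lebesgue)"

definition Lr_norm :: "'a::euclidean_space set \<Rightarrow> real \<Rightarrow> ('a \<Rightarrow> real) \<Rightarrow> real" where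
  "Lr_norm \<Omega> r f = enn2real (Lr_integral \<Omega> r f) powr (1 / r)"

definition gagliardo_integral :: "'a::euclidean_space set \<Rightarrow> real \<Rightarrow> real \<Rightarrow> ('a \<Rightarrow> real) \<Rightarrow> ennreal" where
  "gagliardo_integral \<Omega> t r f = (\<integral>\<^sup>+ z\<in>\<Omega> \<times> \<Omega>.
      ennreal (\<bar>f (fst z) - f (snd z)\<bar> powr r / norm (fst z - snd z) powr (real DIM('a) + t * r)) \<partial>lebesgue)"

definition gagliardo_seminorm :: "'a::euclidean_space set \<Rightarrow> real \<Rightarrow> real \<Rightarrow> ('a \<Rightarrow> real) \<Rightarrow> real" where
  "gagliardo_seminorm \<Omega> t r f = enn2real (gagliardo_integral \<Omega> t r f) powr (1 / r)"

definition W_const :: "'a::euclidean_space set \<Rightarrow> real \<Rightarrow> real \<Rightarrow> ('a \<Rightarrow> real) set" where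
  "W_const \<Omega> t r = {f. f \<in> borel_measurable (lebesgue_on \<Omega>) \<and>
      Lr_integral \<Omega> r f < \<infinity> \<and> gagliardo_integral \<Omega> t r f < \<infinity>}"

end

theory Submission
  imports Defs
begin

text \<open>
  With \<open>u = \<bar>f x - f y\<bar> / (c * \<bar>x - y\<bar> powr s)\<close> the Gagliardo integrand of order \<open>t\<close> and
  exponent \<open>r\<close> equals \<open>c powr r * u powr r * \<bar>x - y\<bar> powr ((s - t) * r - n)\<close>. Where \<open>u \<ge> 1\<close>,
  \<open>u powr r \<le> u powr p\<close> and the boundedness of the domain bounds it by the variable exponent
  integrand; where \<open>u \<le> 1\<close>, it is at most the kernel \<open>\<bar>x - y\<bar> powr ((s - t) * r - n)\<close>, which is
  integrable because \<open>(s - t) * r > 0\<close>. Hence the integral is at most a constant times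
  \<open>c powr r\<close> whenever the modular of \<open>f\<close> at \<open>c\<close> is below 1; take the infimum over \<open>c\<close>.
  The \<open>L\<^sup>r\<close> estimate is the same splitting with \<open>u = \<bar>f x\<bar> / c\<close> and kernel 1.

  The diagonal is a null set of the product, so \<open>p x x\<close> need not be measurable, and
  \<open>nn_integral\<close> is then only a lower integral: the splitting must not assume the
  modular integrand to be measurable.
\<close>

section \<open>Lower integrals\<close>

text \<open>Since \<open>g\<close> may fail to be measurable, the argument runs through simple
  functions: as \<open>k\<close> is positive and finite, dividing one below \<open>k * g\<close> by
  \<open>k\<close> gives a measurable minorant of \<open>g\<close>.\<close>

lemma nn_integral_cmult_le:
  fixes k :: real
  assumes "k > 0"
  shows "(\<integral>\<^sup>+ x. ennreal k * g x \<partial>M) \<le> ennreal k * (\<integral>\<^sup>+ x. g x \<partial>M)"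
  unfolding nn_integral_def[of M "\<lambda>x. ennreal k * g x"]
proof (rule SUP_least)
  fix \<phi> assume "\<phi> \<in> {\<phi>. simple_function M \<phi> \<and> \<phi> \<le> (\<lambda>x. ennreal k * g x)}"
  then have sf: "simple_function M \<phi>" and le: "\<And>x. \<phi> x \<le> ennreal k * g x"
    by (auto simp: le_fun_def)
  have inv: "ennreal k * ennreal (1 / k) = 1"
    using assms by (simp flip: ennreal_mult)
  have \<phi>: "\<phi> x = ennreal k * (ennreal (1 / k) * \<phi> x)" for x
    by (simp add: inv mult.assoc[symmetric])
  have le': "ennreal (1 / k) * \<phi> x \<le> g x" for x
  proof -
    have "ennreal (1 / k) * \<phi> x \<le> ennreal (1 / k) * (ennreal k * g x)"
      by (intro mult_left_mono le) simp
    also have "\<dots> = g x"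
      using inv by (simp add: mult.assoc[symmetric] mult.commute)
    finally show ?thesis .
  qed
  have [measurable]: "\<phi> \<in> borel_measurable M"
    using sf by (rule borel_measurable_simple_function)
  have "integral\<^sup>S M \<phi> = (\<integral>\<^sup>+ x. \<phi> x \<partial>M)"
    using sf by (simp add: nn_integral_eq_simple_integral)
  also have "\<dots> = (\<integral>\<^sup>+ x. ennreal k * (ennreal (1 / k) * \<phi> x) \<partial>M)"
    by (subst \<phi>) simp
  also have "\<dots> = ennreal k * (\<integral>\<^sup>+ x. ennreal (1 / k) * \<phi> x \<partial>M)"
    by (rule nn_integral_cmult) measurable
  also have "\<dots> \<le> ennreal k * (\<integral>\<^sup>+ x. g x \<partial>M)"
    by (intro mult_left_mono nn_integral_mono le') simp
  finally show "integral\<^sup>S M \<phi> \<le> ennreal k * (\<integral>\<^sup>+ x. g x \<partial>M)" .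
qed

text \<open>Lower integrals are subadditive once one summand is measurable: subtracting
  \<open>h\<close> from a simple function below \<open>g + h\<close> leaves a measurable minorant of
  \<open>g\<close>.\<close>

lemma nn_integral_add_le:
  assumes [measurable]: "h \<in> borel_measurable M"
  shows "(\<integral>\<^sup>+ x. g x + h x \<partial>M) \<le> (\<integral>\<^sup>+ x. g x \<partial>M) + (\<integral>\<^sup>+ x. h x \<partial>M)"
  unfolding nn_integral_def[of M "\<lambda>x. g x + h x"]
proof (rule SUP_least)
  fix \<phi> assume "\<phi> \<in> {\<phi>. simple_function M \<phi> \<and> \<phi> \<le> (\<lambda>x. g x + h x)}"
  then have sf: "simple_function M \<phi>" and le: "\<And>x. \<phi> x \<le> g x + h x"
    by (auto simp: le_fun_def)
  have [measurable]: "\<phi> \<in> borel_measurable M"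
    using sf by (rule borel_measurable_simple_function)
  \<comment> \<open>The case distinction avoids \<open>\<infinity> - \<infinity> = \<infinity>\<close> in \<open>ennreal\<close>.\<close>
  define d where "d x = (if \<phi> x \<le> h x then 0 else \<phi> x - h x)" for x
  have [measurable]: "d \<in> borel_measurable M"
    unfolding d_def by measurable
  have "integral\<^sup>S M \<phi> = (\<integral>\<^sup>+ x. \<phi> x \<partial>M)"
    using sf by (simp add: nn_integral_eq_simple_integral)
  also have "\<dots> \<le> (\<integral>\<^sup>+ x. d x + h x \<partial>M)"
  proof (rule nn_integral_mono)
    fix x show "\<phi> x \<le> d x + h x"
      by (auto simp: d_def diff_add_cancel_ennreal)
  qed
  also have "\<dots> = (\<integral>\<^sup>+ x. d x \<partial>M) + (\<integral>\<^sup>+ x. h x \<partial>M)"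
    by (rule nn_integral_add) measurable
  also have "\<dots> \<le> (\<integral>\<^sup>+ x. g x \<partial>M) + (\<integral>\<^sup>+ x. h x \<partial>M)"
  proof (intro add_right_mono nn_integral_mono)
    fix x show "d x \<le> g x"
      using le[of x] by (auto simp: d_def ennreal_minus_le_iff add.commute)
  qed
  finally show "integral\<^sup>S M \<phi> \<le> (\<integral>\<^sup>+ x. g x \<partial>M) + (\<integral>\<^sup>+ x. h x \<partial>M)" .
qed

text \<open>Integrates the pointwise splitting in both estimates: \<open>g\<close> stands for the
  modular integrand, \<open>h\<close> for the measurable kernel.\<close>

lemma nn_integral_le_cmult_add:
  fixes A B :: real
  assumes "A > 0" "B > 0" "h \<in> borel_measurable M"
    and le: "\<And>x. x \<in> S \<Longrightarrow> f x \<le> ennreal A * (ennreal B * g x + h x)" and "S \<in> sets M"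
  shows "(\<integral>\<^sup>+ x\<in>S. f x \<partial>M) \<le> ennreal A * (ennreal B * (\<integral>\<^sup>+ x\<in>S. g x \<partial>M) + (\<integral>\<^sup>+ x\<in>S. h x \<partial>M))"
proof -
  have "(\<integral>\<^sup>+ x\<in>S. f x \<partial>M)
      \<le> (\<integral>\<^sup>+ x. ennreal A * (ennreal B * (g x * indicator S x) + h x * indicator S x) \<partial>M)"
    by (rule nn_integral_mono) (auto simp: indicator_def le)
  also have "\<dots> \<le> ennreal A * (\<integral>\<^sup>+ x. ennreal B * (g x * indicator S x) + h x * indicator S x \<partial>M)"
    by (rule nn_integral_cmult_le[OF assms(1)])
  also have "\<dots> \<le> ennreal A * ((\<integral>\<^sup>+ x. ennreal B * (g x * indicator S x) \<partial>M) + (\<integral>\<^sup>+ x\<in>S. h x \<partial>M))"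
    using assms by (intro mult_left_mono nn_integral_add_le) auto
  also have "\<dots> \<le> ennreal A * (ennreal B * (\<integral>\<^sup>+ x\<in>S. g x \<partial>M) + (\<integral>\<^sup>+ x\<in>S. h x \<partial>M))"
    by (intro mult_left_mono add_right_mono nn_integral_cmult_le[OF assms(2)]) auto
  finally show ?thesis .
qed

section \<open>The kernel\<close>

text \<open>Take the least \<open>n\<close> with \<open>R * (1/2) ^ n \<le> x\<close>. Since
  \<open>x < R\<close> excludes \<open>n = 0\<close>, it has a predecessor \<open>k\<close>, and
  minimality gives the strict upper bound.\<close>

lemma dyadic_bracket:
  fixes x R :: real
  assumes "0 < x" "x < R"
  shows "\<exists>k. R * (1/2) ^ Suc k \<le> x \<and> x < R * (1/2) ^ k"
proof -
  have "\<exists>m. (1/2 :: real) ^ m < x / R"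
    using assms by (intro real_arch_pow_inv) auto
  then obtain m where m: "R * (1/2) ^ m < x"
    using assms by (auto simp: field_simps)
  define n where "n = (LEAST n. R * (1/2) ^ n \<le> x)"
  have n: "R * (1/2) ^ n \<le> x"
    unfolding n_def using LeastI[of "\<lambda>n. R * (1/2) ^ n \<le> x" m] m by simp
  then have "n \<noteq> 0" using assms by (cases n) auto
  then obtain k where k: "n = Suc k" by (cases n) auto
  have "\<not> R * (1/2) ^ k \<le> x"
    using not_less_Least[of k "\<lambda>n. R * (1/2) ^ n \<le> x"] k unfolding n_def by auto
  then show ?thesis using n k by (intro exI[of _ k]) auto
qed

text \<open>On the dyadic shell of outer radius \<open>\<rho> k\<close> the integrand is at most a
  constant times \<open>\<rho> k powr (a - DIM('a))\<close>, while the ball of that radius has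
  volume proportional to \<open>\<rho> k ^ DIM('a)\<close>. The product is geometric in
  \<open>k\<close> with ratio \<open>(1/2) powr a < 1\<close>.\<close>

lemma nn_integral_norm_powr_ball_finite:
  fixes a R :: real
  assumes "a > 0" "R > 0"
  shows "(\<integral>\<^sup>+ z\<in>ball (0::'a::euclidean_space) R. ennreal (norm z powr (a - DIM('a))) \<partial>lborel) < \<infinity>"
proof -
  let ?n = "real DIM('a)"
  define \<rho> where "\<rho> k = R * (1/2) ^ k" for k :: nat
  have \<rho>: "\<rho> k > 0" for k using assms by (simp add: \<rho>_def)
  \<comment> \<open>The factor \<open>2 powr ?n\<close> serves both signs of the exponent: it is at
    least 1 when \<open>a \<ge> ?n\<close>, and otherwise it absorbs the loss
    \<open>2 powr (?n - a)\<close> from evaluating at the inner radius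
    \<open>\<rho> k / 2\<close>.\<close>
  define w where "w k = 2 powr ?n * \<rho> k powr (a - ?n)" for k
  have [measurable]: "ball (0::'a) R \<in> sets borel" for R
    by simp
  have bd: "ennreal (norm z powr (a - ?n)) * indicator (ball 0 R) z
      \<le> (\<Sum>k. ennreal (w k) * indicator (ball 0 (\<rho> k)) z)" for z :: 'a
  proof (cases "z = 0 \<or> norm z \<ge> R")
    \<comment> \<open>At the origin the integrand is 0, because \<open>0 powr b = 0\<close> for
      every \<open>b\<close>.\<close>
    case True then show ?thesis by auto
  next
    case False
    then obtain k where k: "\<rho> (Suc k) \<le> norm z" "norm z < \<rho> k"
      using dyadic_bracket[of "norm z" R] by (auto simp: \<rho>_def)
    have "norm z powr (a - ?n) \<le> w k"
    proof (cases "a \<ge> ?n")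
      case True
      then have "norm z powr (a - ?n) \<le> \<rho> k powr (a - ?n)"
        using k by (intro powr_mono2) auto
      also have "\<dots> \<le> w k"
        unfolding w_def using mult_right_mono[of 1 "2 powr ?n" "\<rho> k powr (a - ?n)"]
        by (simp add: ge_one_powr_ge_zero)
      finally show ?thesis .
    next
      case F: False
      then have "norm z powr (a - ?n) \<le> (\<rho> k / 2) powr (a - ?n)"
        using k \<rho>[of k] by (intro powr_mono2') (auto simp: \<rho>_def)
      also have "\<dots> = \<rho> k powr (a - ?n) * 2 powr (?n - a)"
        using \<rho>[of k] by (simp add: powr_divide powr_diff field_simps)
      also have "\<dots> \<le> \<rho> k powr (a - ?n) * 2 powr ?n"
        using assms by (intro mult_left_mono powr_mono) auto
      finally show ?thesis by (simp add: w_def mult.commute)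
    qed
    then have "ennreal (norm z powr (a - ?n)) * indicator (ball 0 R) z
        \<le> ennreal (w k) * indicator (ball 0 (\<rho> k)) z"
      using k by (auto simp: indicator_def intro: ennreal_leI)
    also have "\<dots> \<le> (\<Sum>k. ennreal (w k) * indicator (ball 0 (\<rho> k)) z)"
      using sum_le_suminf[OF summableI, of "{k}" "\<lambda>k. ennreal (w k) * indicator (ball 0 (\<rho> k)) z"]
      by (simp del: sum_mult_indicator)
    finally show ?thesis .
  qed
  define V where "V = unit_ball_vol ?n"
  have V: "V \<ge> 0" by (simp add: V_def)
  \<comment> \<open>Each shell has been enlarged to the full ball, whose volume is explicit; the
    powers of \<open>\<rho> k\<close> combine to \<open>\<rho> k powr a\<close>.\<close>
  have annulus: "(\<integral>\<^sup>+ z. ennreal (w k) * indicator (ball (0::'a) (\<rho> k)) z \<partial>lborel)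
      = ennreal (2 powr ?n * V * R powr a * ((1/2) powr a) ^ k)" for k
  proof -
    have "(\<integral>\<^sup>+ z. ennreal (w k) * indicator (ball (0::'a) (\<rho> k)) z \<partial>lborel)
        = ennreal (w k) * ennreal (V * \<rho> k ^ DIM('a))"
      using \<rho>[of k] by (simp add: nn_integral_cmult_indicator emeasure_ball V_def)
    also have "\<dots> = ennreal (w k * (V * \<rho> k ^ DIM('a)))"
      using \<rho>[of k] V by (simp add: w_def ennreal_mult)
    also have "w k * (V * \<rho> k ^ DIM('a)) = 2 powr ?n * V * \<rho> k powr a"
      using \<rho>[of k] by (simp add: w_def powr_diff powr_realpow)
    also have "\<rho> k powr a = R powr a * ((1/2) powr a) ^ k"
      using assms by (simp add: \<rho>_def powr_mult powr_power powr_powr flip: powr_realpow)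
         (simp add: mult.commute)
    finally show ?thesis by (simp add: mult.assoc)
  qed
  have q: "(1/2::real) powr a < 1"
    using powr_less_mono2[of a "1/2" 1] assms by simp
  have "(\<integral>\<^sup>+ z\<in>ball (0::'a) R. ennreal (norm z powr (a - ?n)) \<partial>lborel)
      \<le> (\<integral>\<^sup>+ z. (\<Sum>k. ennreal (w k) * indicator (ball (0::'a) (\<rho> k)) z) \<partial>lborel)"
    by (intro nn_integral_mono bd)
  also have "\<dots> = (\<Sum>k. ennreal (2 powr ?n * V * R powr a * ((1/2) powr a) ^ k))"
    by (subst nn_integral_suminf) (measurable, simp add: annulus)
  also have "\<dots> < \<infinity>"
  proof -
    have "summable (\<lambda>k. 2 powr ?n * V * R powr a * ((1/2) powr a) ^ k)"
      using q by (intro summable_mult summable_geometric) auto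
    then show ?thesis
      using V by (subst suminf_ennreal2) auto
  qed
  finally show ?thesis .
qed

text \<open>For fixed \<open>x\<close> in \<open>\<Omega>\<close> the differences
  \<open>y - x\<close> stay in a ball of radius \<open>2 * R\<close>, so the inner integral is
  bounded uniformly in \<open>x\<close>; the outer one then costs only the finite measure of
  \<open>\<Omega>\<close>.\<close>

lemma nn_integral_kernel_finite:
  fixes \<Omega> :: "'a::euclidean_space set" and a :: real
  assumes "bounded \<Omega>" "open \<Omega>" "a > 0"
  shows "(\<integral>\<^sup>+ z\<in>\<Omega> \<times> \<Omega>. ennreal (norm (fst z - snd z) powr (a - DIM('a))) \<partial>lebesgue) < \<infinity>"
proof -
  let ?k = "\<lambda>z::'a. ennreal (norm z powr (a - DIM('a)))"
  obtain R where R: "R > 0" "\<And>x. x \<in> \<Omega> \<Longrightarrow> norm x < R"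
    using assms(1) by (auto simp: bounded_pos_less)
  have [measurable]: "\<Omega> \<in> sets borel" "ball (0::'a) (2 * R) \<in> sets borel"
    using assms by auto
  let ?K = "\<integral>\<^sup>+ z\<in>ball (0::'a) (2 * R). ?k z \<partial>lborel"
  have K: "?K < \<infinity>"
    using assms R by (intro nn_integral_norm_powr_ball_finite) auto
  have inner: "(\<integral>\<^sup>+ y. ?k (x - y) * indicator (\<Omega> \<times> \<Omega>) (x, y) \<partial>lborel) \<le> ?K * indicator \<Omega> x" for x
  proof (cases "x \<in> \<Omega>")
    case True
    \<comment> \<open>The kernel is even, so \<open>x - y\<close> may be replaced by
      \<open>y - x\<close>, which is a translation in \<open>y\<close>.\<close>
    have "(\<integral>\<^sup>+ y. ?k (x - y) * indicator (\<Omega> \<times> \<Omega>) (x, y) \<partial>lborel)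
        \<le> (\<integral>\<^sup>+ y. ?k (y - x) * indicator (ball 0 (2 * R)) (y - x) \<partial>lborel)"
    proof (rule nn_integral_mono)
      fix y
      have "norm (y - x) < 2 * R" if "y \<in> \<Omega>"
        using norm_triangle_ineq4[of y x] R(2)[OF that] R(2)[OF True] by linarith
      then show "?k (x - y) * indicator (\<Omega> \<times> \<Omega>) (x, y)
          \<le> ?k (y - x) * indicator (ball 0 (2 * R)) (y - x)"
        by (auto simp: indicator_def norm_minus_commute)
    qed
    also have "\<dots> = (\<integral>\<^sup>+ y. ?k y * indicator (ball 0 (2 * R)) y \<partial>distr lborel borel ((+) (- x)))"
    proof -
      have "(\<lambda>y. ?k y * indicator (ball 0 (2 * R)) y) \<in> borel_measurable borel"
        by measurable
      then show ?thesis
        using nn_integral_distr[of "(+) (- x)" lborel borel "\<lambda>y. ?k y * indicator (ball 0 (2 * R)) y"]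
        by simp
    qed
    also have "\<dots> = ?K"
      by (simp add: lborel_distr_plus)
    finally show ?thesis using True by simp
  next
    case False then show ?thesis by simp
  qed
  \<comment> \<open>Passing from \<open>lebesgue\<close> to the product of \<open>lborel\<close>
    measures makes Tonelli applicable; completion does not change the integral.\<close>
  have "(\<integral>\<^sup>+ z\<in>\<Omega> \<times> \<Omega>. ?k (fst z - snd z) \<partial>lebesgue)
      = (\<integral>\<^sup>+ z\<in>\<Omega> \<times> \<Omega>. ?k (fst z - snd z) \<partial>(lborel \<Otimes>\<^sub>M lborel))"
    unfolding lborel_prod by (rule nn_integral_completion)
  also have "\<dots> = (\<integral>\<^sup>+ x. \<integral>\<^sup>+ y. ?k (x - y) * indicator (\<Omega> \<times> \<Omega>) (x, y) \<partial>lborel \<partial>lborel)"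
    by (subst lborel.nn_integral_fst[symmetric]) (auto simp: borel_prod)
  also have "\<dots> \<le> (\<integral>\<^sup>+ x. ?K * indicator \<Omega> x \<partial>lborel)"
    by (intro nn_integral_mono inner)
  also have "\<dots> = ?K * emeasure lborel \<Omega>"
    by (rule nn_integral_cmult_indicator) simp
  also have "\<dots> < \<infinity>"
    using K emeasure_bounded_finite[OF assms(1)] by (simp add: ennreal_mult_less_top)
  finally show ?thesis .
qed

section \<open>Luxemburg gauges\<close>

text \<open>Common end of both estimates, with \<open>m\<close> the modular. Every admissible
  \<open>c\<close> has \<open>m c < 1\<close>, hence \<open>I \<le> c powr r * (A + B)\<close>; take
  roots and then the infimum over \<open>c\<close>.\<close>

lemma luxemburg_gauge_bound:
  fixes m :: "real \<Rightarrow> ennreal" and A B r :: real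
  assumes fin: "\<exists>c>0. m c < \<infinity>"
    and scale: "\<And>k c. k \<ge> 1 \<Longrightarrow> c > 0 \<Longrightarrow> m (k * c) \<le> ennreal (1 / k) * m c"
    and bound: "\<And>c. c > 0 \<Longrightarrow> I \<le> ennreal (c powr r) * (ennreal A * m c + ennreal B)"
    and "A > 0" "B \<ge> 0" "r > 0"
  shows "I < \<infinity>"
    and "enn2real I powr (1 / r) \<le> (A + B) powr (1 / r) * Inf {c. c > 0 \<and> m c < 1}"
proof -
  from fin obtain c M where c: "c > 0" "m c = ennreal M" "M \<ge> 0"
    by (auto simp: less_top_ennreal)
  have "I \<le> ennreal (c powr r) * (ennreal A * m c + ennreal B)"
    by (rule bound[OF c(1)])
  also have "\<dots> < \<infinity>"
    by (simp add: c ennreal_mult_less_top)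
  finally show fin_I: "I < \<infinity>" .
  \<comment> \<open>Scaling by \<open>M + 1\<close> brings the finite value \<open>M\<close> down to
    \<open>M / (M + 1) < 1\<close>, so the infimum is over a nonempty set.\<close>
  have "m ((M + 1) * c) \<le> ennreal (1 / (M + 1)) * ennreal M"
    using scale[of "M + 1" c] c by simp
  also have "\<dots> = ennreal (M / (M + 1))"
    using c by (simp flip: ennreal_mult)
  also have "\<dots> < 1"
    using c by (simp add: ennreal_less_one_iff)
  finally have ne: "{c. c > 0 \<and> m c < 1} \<noteq> {}"
    using c by (auto intro!: exI[of _ "(M + 1) * c"] mult_pos_pos)
  have AB: "(A + B) powr (1 / r) > 0" using assms by simp
  have "enn2real I powr (1 / r) / (A + B) powr (1 / r) \<le> Inf {c. c > 0 \<and> m c < 1}"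
  proof (rule cInf_greatest[OF ne])
    fix c assume "c \<in> {c. c > 0 \<and> m c < 1}"
    then have c: "c > 0" "m c < 1" by auto
    have "I \<le> ennreal (c powr r) * (ennreal A * m c + ennreal B)"
      by (rule bound[OF c(1)])
    also have "\<dots> \<le> ennreal (c powr r) * (ennreal A * 1 + ennreal B)"
      using c by (intro mult_left_mono add_right_mono) auto
    also have "\<dots> = ennreal (c powr r * (A + B))"
      using assms by (simp add: ennreal_mult ennreal_plus)
    finally have "enn2real I \<le> c powr r * (A + B)"
      using assms by (simp add: enn2real_leI)
    then have "enn2real I powr (1 / r) \<le> (c powr r * (A + B)) powr (1 / r)"
      using assms by (intro powr_mono2) auto
    also have "\<dots> = c * (A + B) powr (1 / r)"
      using assms c by (simp add: powr_mult powr_powr)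
    finally show "enn2real I powr (1 / r) / (A + B) powr (1 / r) \<le> c"
      using AB by (simp add: field_simps)
  qed
  then show "enn2real I powr (1 / r) \<le> (A + B) powr (1 / r) * Inf {c. c > 0 \<and> m c < 1}"
    using AB by (simp add: field_simps)
qed

text \<open>The splitting at \<open>u = 1\<close> in additive form, so that no domain of integration
  has to be cut along a level set of \<open>u\<close>.\<close>

lemma powr_le_one_add_powr:
  fixes u r q :: real
  assumes "u \<ge> 0" "0 < r" "r \<le> q"
  shows "u powr r \<le> u powr q + 1"
proof (cases "u \<le> 1")
  case True
  then have "u powr r \<le> 1" using assms by (simp add: powr_le1)
  then show ?thesis by (simp add: add_increasing)
next
  case False
  then have "u powr r \<le> u powr q" using assms by (intro powr_mono) auto
  then show ?thesis by simp
qed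

lemma powr_inverse_le:
  fixes k q :: real
  assumes "k \<ge> 1" "q \<ge> 1"
  shows "1 / k powr q \<le> 1 / k"
  using powr_mono[of 1 q k] assms by (intro divide_left_mono) auto

section \<open>The two estimates\<close>

text \<open>Scaling by \<open>k\<close> brings out \<open>1 / k powr e x\<close>, which varies with
  \<open>x\<close>; \<open>e x \<ge> 1\<close> bounds it by the constant \<open>1 / k\<close>
  required for \<open>luxemburg_gauge_bound\<close>.\<close>

lemma var_modular_scale:
  assumes e: "\<And>x. x \<in> \<Omega> \<Longrightarrow> 1 \<le> e x" and "k \<ge> 1" "c > 0"
  shows "var_modular \<Omega> e f (k * c) \<le> ennreal (1 / k) * var_modular \<Omega> e f c"
proof -
  have *: "(\<bar>f x\<bar> / (k * c)) powr e x \<le> 1 / k * (\<bar>f x\<bar> / c) powr e x" if "x \<in> \<Omega>" for x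
  proof -
    have "(\<bar>f x\<bar> / (k * c)) powr e x = 1 / k powr e x * (\<bar>f x\<bar> / c) powr e x"
      using assms by (simp add: powr_divide powr_mult)
    then show ?thesis
      using powr_inverse_le[OF assms(2) e[OF that]] by (metis mult_right_mono powr_ge_zero)
  qed
  have "var_modular \<Omega> e f (k * c)
      \<le> (\<integral>\<^sup>+ x. ennreal (1 / k) * (ennreal ((\<bar>f x\<bar> / c) powr e x) * indicator \<Omega> x) \<partial>lebesgue)"
    unfolding var_modular_def using assms *
    by (intro nn_integral_mono) (auto simp: indicator_def simp flip: ennreal_mult intro!: ennreal_leI)
  also have "\<dots> \<le> ennreal (1 / k) * var_modular \<Omega> e f c"
    unfolding var_modular_def using assms by (intro nn_integral_cmult_le) auto
  finally show ?thesis .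
qed

text \<open>The kernel 1 integrates to the measure of \<open>\<Omega>\<close>. The factor
  \<open>ennreal 1\<close> gives the shape of \<open>luxemburg_gauge_bound\<close> with
  \<open>A = 1\<close>.\<close>

lemma Lr_integral_le_var_modular:
  assumes "open \<Omega>" and e: "\<And>x. x \<in> \<Omega> \<Longrightarrow> r \<le> e x" and "r > 0" "c > 0"
  shows "Lr_integral \<Omega> r f
    \<le> ennreal (c powr r) * (ennreal 1 * var_modular \<Omega> e f c + emeasure lebesgue \<Omega>)"
proof -
  have *: "ennreal (\<bar>f x\<bar> powr r)
      \<le> ennreal (c powr r) * (ennreal 1 * ennreal ((\<bar>f x\<bar> / c) powr e x) + 1)"
    if "x \<in> \<Omega>" for x
  proof -
    have "\<bar>f x\<bar> powr r = c powr r * (\<bar>f x\<bar> / c) powr r"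
      using assms by (simp add: powr_divide)
    also have "\<dots> \<le> c powr r * ((\<bar>f x\<bar> / c) powr e x + 1)"
      using assms e[OF that] by (intro mult_left_mono powr_le_one_add_powr) auto
    finally have "ennreal (\<bar>f x\<bar> powr r) \<le> ennreal (c powr r * ((\<bar>f x\<bar> / c) powr e x + 1))"
      by (rule ennreal_leI)
    then show ?thesis by (simp add: ennreal_mult)
  qed
  show ?thesis
    unfolding Lr_integral_def var_modular_def
    using nn_integral_le_cmult_add[where M = lebesgue and h = "\<lambda>_. 1" and S = \<Omega>, OF _ _ _ *] assms
    by simp
qed

lemma frac_modular_scale:
  fixes \<Omega> :: "'a::euclidean_space set"
  assumes p: "\<And>x y. x \<in> \<Omega> \<Longrightarrow> y \<in> \<Omega> \<Longrightarrow> 1 \<le> p x y" and "k \<ge> 1" "c > 0"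
  shows "frac_modular \<Omega> s p f (k * c) \<le> ennreal (1 / k) * frac_modular \<Omega> s p f c"
proof -
  let ?g = "\<lambda>c z. \<bar>f (fst z) - f (snd z)\<bar> powr p (fst z) (snd z) /
        (c powr p (fst z) (snd z) * norm (fst z - snd z) powr (real DIM('a) + s * p (fst z) (snd z)))"
  have *: "?g (k * c) z \<le> 1 / k * ?g c z" if "z \<in> \<Omega> \<times> \<Omega>" for z
  proof -
    have "1 \<le> p (fst z) (snd z)" using that by (auto intro: p)
    note le = powr_inverse_le[OF assms(2) this]
    have "?g (k * c) z = 1 / k powr p (fst z) (snd z) * ?g c z"
      using assms by (simp add: powr_mult)
    also have "\<dots> \<le> 1 / k * ?g c z"
      by (rule mult_right_mono[OF le]) simp
    finally show ?thesis .
  qed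
  have "frac_modular \<Omega> s p f (k * c)
      \<le> (\<integral>\<^sup>+ z. ennreal (1 / k) * (ennreal (?g c z) * indicator (\<Omega> \<times> \<Omega>) z) \<partial>lebesgue)"
    unfolding frac_modular_def
  proof (rule nn_integral_mono)
    fix z
    show "ennreal (?g (k * c) z) * indicator (\<Omega> \<times> \<Omega>) z
        \<le> ennreal (1 / k) * (ennreal (?g c z) * indicator (\<Omega> \<times> \<Omega>) z)"
    proof (cases "z \<in> \<Omega> \<times> \<Omega>")
      case True
      have "ennreal (?g (k * c) z) \<le> ennreal (1 / k * ?g c z)"
        by (rule ennreal_leI[OF *[OF True]])
      also have "\<dots> = ennreal (1 / k) * ennreal (?g c z)"
        using assms by (intro ennreal_mult) auto
      finally show ?thesis using True by simp
    qed simp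
  qed
  also have "\<dots> \<le> ennreal (1 / k) * frac_modular \<Omega> s p f c"
    unfolding frac_modular_def using assms by (intro nn_integral_cmult_le) auto
  finally show ?thesis .
qed

text \<open>Substituting \<open>a = c * d powr s * u\<close> leaves the weight
  \<open>d powr ((s - t) * r - n)\<close> beside \<open>u powr r\<close>. Neither this weight nor
  \<open>D powr ((s - t) * r)\<close> involves \<open>q\<close>, so the bound stays uniform when
  \<open>q\<close> varies from point to point.\<close>

lemma gagliardo_integrand_bound:
  fixes a c d D n q r s t :: real
  assumes "a \<ge> 0" "c > 0" "d \<ge> 0" "d \<le> D" "0 < r" "r \<le> q" "t < s"
  shows "a powr r / d powr (n + t * r)
    \<le> c powr r * (D powr ((s - t) * r) * (a powr q / (c powr q * d powr (n + s * q)))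
        + d powr ((s - t) * r - n))"
\<comment> \<open>For \<open>d = 0\<close> the left side is a division by 0, hence 0.\<close>
proof (cases "d = 0")
  case False
  then have d: "d > 0" using assms by simp
  define u where "u = a / (c * d powr s)"
  have u: "u \<ge> 0" using assms d by (simp add: u_def)
  have a: "a = c * d powr s * u" using assms d by (simp add: u_def)
  have "a powr r / d powr (n + t * r) = c powr r * (d powr ((s - t) * r) * u powr r / d powr n)"
    using assms d u
    by (simp add: a powr_mult powr_powr powr_add powr_diff left_diff_distrib) (simp add: mult_ac)
  also have "\<dots> \<le> c powr r * (d powr ((s - t) * r) * (u powr q + 1) / d powr n)"
    using assms u by (intro mult_left_mono divide_right_mono powr_le_one_add_powr) auto
  also have "\<dots> = c powr r * (d powr ((s - t) * r) * (u powr q / d powr n) + d powr ((s - t) * r - n))"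
    using d by (simp add: powr_diff add_divide_distrib distrib_left)
  \<comment> \<open>Only the weight of \<open>u powr q\<close> is enlarged to a power of
    \<open>D\<close>; the other one is kept as the integrable kernel.\<close>
  also have "\<dots> \<le> c powr r * (D powr ((s - t) * r) * (u powr q / d powr n) + d powr ((s - t) * r - n))"
    using assms by (intro mult_left_mono add_right_mono mult_right_mono powr_mono2) auto
  also have "u powr q / d powr n = a powr q / (c powr q * d powr (n + s * q))"
    using assms d by (simp add: u_def powr_divide powr_mult powr_powr powr_add)
  finally show ?thesis .
qed simp

lemma gagliardo_integral_le_frac_modular:
  fixes \<Omega> :: "'a::euclidean_space set"
  assumes "open \<Omega>" and p: "\<And>x y. x \<in> \<Omega> \<Longrightarrow> y \<in> \<Omega> \<Longrightarrow> r \<le> p x y"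
    and D: "\<And>x y. x \<in> \<Omega> \<Longrightarrow> y \<in> \<Omega> \<Longrightarrow> norm (x - y) \<le> D" and "D > 0"
    and "r > 0" "c > 0" "t < s"
  shows "gagliardo_integral \<Omega> t r f
    \<le> ennreal (c powr r) * (ennreal (D powr ((s - t) * r)) * frac_modular \<Omega> s p f c
        + (\<integral>\<^sup>+ z\<in>\<Omega> \<times> \<Omega>. ennreal (norm (fst z - snd z) powr ((s - t) * r - DIM('a))) \<partial>lebesgue))"
  unfolding gagliardo_integral_def frac_modular_def
proof (rule nn_integral_le_cmult_add)
  show "(\<lambda>z::'a \<times> 'a. ennreal (norm (fst z - snd z) powr ((s - t) * r - DIM('a))))
      \<in> borel_measurable lebesgue"
    by (rule measurable_completion) (simp add: borel_prod[symmetric])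
  show "\<Omega> \<times> \<Omega> \<in> sets lebesgue"
    using assms(1) by (simp add: open_Times lmeasurable_open)
  fix z assume "z \<in> \<Omega> \<times> \<Omega>"
  then have z: "fst z \<in> \<Omega>" "snd z \<in> \<Omega>" by auto
  note b = ennreal_leI[OF gagliardo_integrand_bound[of "\<bar>f (fst z) - f (snd z)\<bar>" c "norm (fst z - snd z)"
        D r "p (fst z) (snd z)" t s "real DIM('a)"]]
  show "ennreal (\<bar>f (fst z) - f (snd z)\<bar> powr r / norm (fst z - snd z) powr (real DIM('a) + t * r))
      \<le> ennreal (c powr r) * (ennreal (D powr ((s - t) * r)) *
        ennreal (\<bar>f (fst z) - f (snd z)\<bar> powr p (fst z) (snd z) /
          (c powr p (fst z) (snd z) * norm (fst z - snd z) powr (real DIM('a) + s * p (fst z) (snd z))))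
        + ennreal (norm (fst z - snd z) powr ((s - t) * r - real DIM('a))))"
    using b D[OF z] p[OF z] assms by (simp add: ennreal_mult del: times_divide_eq_right)
qed (use assms in auto)

theorem theorem2p2:
  fixes \<Omega> :: "'a::euclidean_space set" and s t r pm pp :: real
  assumes "smooth_bounded_domain \<Omega>"
    and "0 < s" "s < 1"
    and "1 < pm" "pm \<le> pp"
    and "0 < t" "t < s"
    and "1 < r" "r < pm"
  shows "\<exists>C>0. \<forall>p :: 'a \<Rightarrow> 'a \<Rightarrow> real.
           (\<lambda>z. p (fst z) (snd z)) \<in> borel_measurable (lebesgue_on (\<Omega> \<times> \<Omega>)) \<and>
           (\<forall>x\<in>\<Omega>. \<forall>y\<in>\<Omega>. pm \<le> p x y \<and> p x y \<le> pp) \<and>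
           pm = (INF z\<in>\<Omega> \<times> \<Omega>. p (fst z) (snd z)) \<and>
           pp = (SUP z\<in>\<Omega> \<times> \<Omega>. p (fst z) (snd z)) \<longrightarrow>
           (\<forall>f\<in>W_var \<Omega> s p.
              f \<in> W_const \<Omega> t r \<and>
              Lr_norm \<Omega> r f \<le> C * var_norm \<Omega> (\<lambda>x. p x x) f \<and>
              gagliardo_seminorm \<Omega> t r f \<le> C * var_seminorm \<Omega> s p f)"
proof -
  have op: "open \<Omega>" and bd: "bounded \<Omega>"
    using assms(1) by (auto simp: smooth_bounded_domain_def)
  \<comment> \<open>The summand 1 makes \<open>D > 0\<close> immediate from nonnegativity of the
    diameter.\<close>
  define D where "D = diameter \<Omega> + 1"
  have D: "D > 0" "\<And>x y. x \<in> \<Omega> \<Longrightarrow> y \<in> \<Omega> \<Longrightarrow> norm (x - y) \<le> D"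
    using diameter_bounded_bound[OF bd] diameter_ge_0[OF bd]
    by (auto simp: D_def dist_norm intro: add_increasing2)
  define A where "A = D powr ((s - t) * r)"
  obtain K where K: "K \<ge> 0"
    "(\<integral>\<^sup>+ z\<in>\<Omega> \<times> \<Omega>. ennreal (norm (fst z - snd z) powr ((s - t) * r - DIM('a))) \<partial>lebesgue) = ennreal K"
    using nn_integral_kernel_finite[OF bd op, of "(s - t) * r"] assms
    by (auto simp: less_top_ennreal)
  obtain V where V: "V \<ge> 0" "emeasure lebesgue \<Omega> = ennreal V"
    using emeasure_bounded_finite[OF bd] op by (auto simp: less_top_ennreal)
  \<comment> \<open>Both constants have the form \<open>(A + B) powr (1 / r)\<close> from
    \<open>luxemburg_gauge_bound\<close>, and both are fixed before \<open>p\<close> and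
    \<open>f\<close> are introduced.\<close>
  define C1 where "C1 = (1 + V) powr (1 / r)"
  define C2 where "C2 = (A + K) powr (1 / r)"
  have A: "A > 0" using D by (simp add: A_def)
  have C: "C1 > 0" "C2 > 0" using V K A by (auto simp: C1_def C2_def)
  show ?thesis
  proof (intro exI[of _ "C1 + C2"] conjI allI impI ballI)
    show "C1 + C2 > 0" using C by simp
    fix p :: "'a \<Rightarrow> 'a \<Rightarrow> real" and f
    assume "(\<lambda>z. p (fst z) (snd z)) \<in> borel_measurable (lebesgue_on (\<Omega> \<times> \<Omega>)) \<and>
           (\<forall>x\<in>\<Omega>. \<forall>y\<in>\<Omega>. pm \<le> p x y \<and> p x y \<le> pp) \<and>
           pm = (INF z\<in>\<Omega> \<times> \<Omega>. p (fst z) (snd z)) \<and>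
           pp = (SUP z\<in>\<Omega> \<times> \<Omega>. p (fst z) (snd z))"
    then have p: "pm \<le> p x y" if "x \<in> \<Omega>" "y \<in> \<Omega>" for x y
      using that by blast
    have p1: "1 \<le> p x y" and pr: "r \<le> p x y" if "x \<in> \<Omega>" "y \<in> \<Omega>" for x y
      using p[OF that] assms by auto
    assume "f \<in> W_var \<Omega> s p"
    then have f: "f \<in> borel_measurable (lebesgue_on \<Omega>)"
      "\<exists>c>0. var_modular \<Omega> (\<lambda>x. p x x) f c < \<infinity>" "\<exists>c>0. frac_modular \<Omega> s p f c < \<infinity>"
      by (auto simp: W_var_def var_Lp_def)
    have Lr_le: "Lr_integral \<Omega> r f
        \<le> ennreal (c powr r) * (ennreal 1 * var_modular \<Omega> (\<lambda>x. p x x) f c + ennreal V)" if "c > 0" for c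
      unfolding V(2)[symmetric] using that assms pr op by (intro Lr_integral_le_var_modular) auto
    have L: "Lr_integral \<Omega> r f < \<infinity>" "Lr_norm \<Omega> r f \<le> C1 * var_norm \<Omega> (\<lambda>x. p x x) f"
      unfolding Lr_norm_def C1_def var_norm_def
      using luxemburg_gauge_bound[OF f(2) _ Lr_le] var_modular_scale[of \<Omega> "\<lambda>x. p x x"] p1 V assms
      by auto
    have gagliardo_le: "gagliardo_integral \<Omega> t r f
        \<le> ennreal (c powr r) * (ennreal A * frac_modular \<Omega> s p f c + ennreal K)" if "c > 0" for c
      unfolding K(2)[symmetric] A_def
      using that assms pr op D by (intro gagliardo_integral_le_frac_modular) auto
    have G: "gagliardo_integral \<Omega> t r f < \<infinity>"
      "gagliardo_seminorm \<Omega> t r f \<le> C2 * var_seminorm \<Omega> s p f"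
      unfolding gagliardo_seminorm_def C2_def var_seminorm_def
      using luxemburg_gauge_bound[OF f(3) _ gagliardo_le] frac_modular_scale[of \<Omega> p] p1 K A assms
      by auto
    show "f \<in> W_const \<Omega> t r"
      using f L G by (simp add: W_const_def)
    \<comment> \<open>Nonnegativity of the two infima follows from the estimates just proved, whose
      left sides are nonnegative and whose constants are positive. It allows \<open>C1\<close> and
      \<open>C2\<close> to be replaced by their sum.\<close>
    have nonneg: "0 \<le> var_norm \<Omega> (\<lambda>x. p x x) f" "0 \<le> var_seminorm \<Omega> s p f"
    proof -
      have "0 \<le> C1 * var_norm \<Omega> (\<lambda>x. p x x) f"
        using L(2) by (rule order_trans[rotated]) (simp add: Lr_norm_def)
      then show "0 \<le> var_norm \<Omega> (\<lambda>x. p x x) f"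
        using C by (simp add: zero_le_mult_iff)
      have "0 \<le> C2 * var_seminorm \<Omega> s p f"
        using G(2) by (rule order_trans[rotated]) (simp add: gagliardo_seminorm_def)
      then show "0 \<le> var_seminorm \<Omega> s p f"
        using C by (simp add: zero_le_mult_iff)
    qed
    show "Lr_norm \<Omega> r f \<le> (C1 + C2) * var_norm \<Omega> (\<lambda>x. p x x) f"
      using L(2) nonneg C by (simp add: distrib_right add_increasing2)
    show "gagliardo_seminorm \<Omega> t r f \<le> (C1 + C2) * var_seminorm \<Omega> s p f"
      using G(2) nonneg C by (simp add: distrib_right add_increasing)
  qed
qed

end
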